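(* Let $n,k$ be integers with $n\ge k>2$. There exists a universal cycle for the set of all functions $\{1,\dots,n\}\to\{1,\dots,k\}$ that are not onto, i.e., the $n$-letter words over the alphabet $[k]=\{1,\dots,k\}$ in which at least one letter of $[k]$ does not occur.
   Context: For a set $\mathcal{C}$ of $n$-letter words over an alphabet, a universal cycle (U-cycle) for $\mathcal{C}$ is a cyclic sequence $x_1x_2\dots x_N$ with $N=|\mathcal{C}|$ such that the $N$ words $x_ix_{i+1}\dots x_{i+n-1}$ ($1\le i\le N$, indices taken modulo $N$) are exactly the words of $\mathcal{C}$, each occurring exactly once. *)

theory Defs
  imports Main "HOL-Library.FuncSet"
begin

definition cyclic_window :: "'a list \<Rightarrow> nat \<Rightarrow> nat \<Rightarrow> 'a list" where
  "cyclic_window xs n i = map (\<lambda>j. xs ! ((i + j) mod length xs)) [0..<n]"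

text \<open>Positions of the cyclic sequence are counted from 0. Its length may be smaller than \<open>n\<close>,
  in which case a window wraps around more than once.\<close>

definition universal_cycle :: "nat \<Rightarrow> 'a list set \<Rightarrow> 'a list \<Rightarrow> bool" where
  "universal_cycle n C xs \<longleftrightarrow>
     length xs = card C \<and> bij_betw (cyclic_window xs n) {..<length xs} C"

definition word_of_fun :: "nat \<Rightarrow> (nat \<Rightarrow> 'a) \<Rightarrow> 'a list" where
  "word_of_fun n f = map f [1..<Suc n]"

definition non_onto_funs :: "nat \<Rightarrow> nat \<Rightarrow> (nat \<Rightarrow> nat) set" where
  "non_onto_funs n k = {f \<in> {1..n} \<rightarrow>\<^sub>E {1..k}. f ` {1..n} \<noteq> {1..k}}"

definition non_onto_words :: "nat \<Rightarrow> nat \<Rightarrow> nat list set" where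
  "non_onto_words n k = word_of_fun n ` non_onto_funs n k"

lemma non_onto_words_eq:
  "non_onto_words n k =
     {w. length w = n \<and> set w \<subseteq> {1..k} \<and> (\<exists>a\<in>{1..k}. a \<notin> set w)}" (is "_ = ?R")
proof
  have img: "set (word_of_fun n f) = f ` {1..n}" for f :: "nat \<Rightarrow> nat"
    by (simp add: word_of_fun_def atLeastLessThanSuc_atLeastAtMost del: upt_Suc)
  show "non_onto_words n k \<subseteq> ?R"
  proof
    fix w assume "w \<in> non_onto_words n k"
    then obtain f where f: "f \<in> {1..n} \<rightarrow>\<^sub>E {1..k}" "f ` {1..n} \<noteq> {1..k}"
      and w: "w = word_of_fun n f"
      by (auto simp: non_onto_words_def non_onto_funs_def)
    have sub: "f ` {1..n} \<subseteq> {1..k}" using f(1) by blast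
    then have "\<exists>a\<in>{1..k}. a \<notin> f ` {1..n}" using f(2) by blast
    moreover have "length w = n" by (simp add: w word_of_fun_def del: upt_Suc)
    ultimately show "w \<in> ?R" using sub img[of f] w by simp
  qed
  show "?R \<subseteq> non_onto_words n k"
  proof
    fix w assume w: "w \<in> ?R"
    define f where "f = restrict (\<lambda>i. w ! (i - 1)) {1..n}"
    have weq: "word_of_fun n f = w"
      using w by (intro nth_equalityI) (auto simp: word_of_fun_def f_def simp del: upt_Suc)
    have im: "f ` {1..n} = set w" using img[of f] weq by simp
    have "f \<in> {1..n} \<rightarrow>\<^sub>E {1..k}"
      using w im by (auto simp: f_def)
    moreover have "f ` {1..n} \<noteq> {1..k}" using w im by blast
    ultimately show "w \<in> non_onto_words n k"
      using weq unfolding non_onto_words_def non_onto_funs_def by blast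
  qed
qed

end

theory Submission
  imports Defs "Graph_Theory.Euler"
begin

text \<open>The words of a rotation-closed set \<open>C\<close> are the arcs of a digraph on their prefixes of
  length \<open>n - 1\<close>, where \<open>w\<close> runs from its longest proper prefix to its longest proper suffix.
  Rotation matches the arcs entering a vertex with those leaving it, so this digraph is balanced,
  and a closed Euler trail, read through first letters, is a universal cycle. For the
  words missing a letter of \<open>[k]\<close> the digraph is strongly connected: from a vertex \<open>u\<close> one walks to
  a constant word over a letter of \<open>u\<close>, then, as \<open>k > 2\<close>, to any other constant word, and from
  there to any vertex using its letter.\<close>

text \<open>For words of length \<open>n\<close> this is a subgraph of the de Bruijn graph. Only
  prefixes of words of \<open>C\<close> are vertices, so none is isolated and connectedness concerns
  the arcs alone.\<close>

definition word_graph :: "'a list set \<Rightarrow> ('a list, 'a list) pre_digraph" where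
  "word_graph C = \<lparr>verts = butlast ` C, arcs = C, tail = butlast, head = tl\<rparr>"

lemma word_graph_simps [simp]:
  "verts (word_graph C) = butlast ` C" "arcs (word_graph C) = C"
  "tail (word_graph C) = butlast" "head (word_graph C) = tl"
  by (simp_all add: word_graph_def)

lemma butlast_rotate1: "butlast (rotate1 w) = tl w"
  by (cases w) simp_all

lemma wf_digraph_word_graph:
  assumes "\<And>w. rotate1 w \<in> C \<longleftrightarrow> w \<in> C"
  shows "wf_digraph (word_graph C)"
proof
  fix w assume "w \<in> arcs (word_graph C)"
  \<comment> \<open>The head \<open>tl w\<close> is the prefix of the rotated word, hence a
    vertex.\<close>
  then have "rotate1 w \<in> C" using assms by simp
  then show "head (word_graph C) w \<in> verts (word_graph C)"
    using butlast_rotate1[of w] by (auto simp: image_iff) metis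
qed simp

lemma word_graph_balanced:
  assumes "\<And>w. rotate1 w \<in> C \<longleftrightarrow> w \<in> C"
  shows "in_degree (word_graph C) v = out_degree (word_graph C) v"
proof -
  have "bij_betw rotate1 {w \<in> C. tl w = v} {w \<in> C. butlast w = v}"
    unfolding bij_betw_def
  proof
    show "inj_on rotate1 {w \<in> C. tl w = v}"
      by (rule inj_on_subset[OF inj_rotate1]) simp
    show "rotate1 ` {w \<in> C. tl w = v} = {w \<in> C. butlast w = v}"
    proof (intro subset_antisym subsetI)
      fix w assume "w \<in> {w \<in> C. butlast w = v}"
      moreover obtain w' where "w = rotate1 w'" using surj_rotate1 by (metis surjD)
      ultimately show "w \<in> rotate1 ` {w \<in> C. tl w = v}"
        using assms by (simp add: butlast_rotate1)
    qed (auto simp: assms butlast_rotate1)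
  qed
  then show ?thesis
    by (simp add: in_degree_def out_degree_def in_arcs_def out_arcs_def bij_betw_same_card)
qed

lemma cas_tail_hd:
  "pre_digraph.cas G u p v \<Longrightarrow> p \<noteq> [] \<Longrightarrow> tail G (hd p) = u"
  by (cases p) (auto simp: pre_digraph.cas.simps)

lemma cas_head_last:
  "pre_digraph.cas G u p v \<Longrightarrow> p \<noteq> [] \<Longrightarrow> head G (last p) = v"
proof (induction p arbitrary: u)
  case (Cons e p)
  then show ?case by (cases p) (auto simp: pre_digraph.cas.simps)
qed simp

lemma cas_nth:
  "pre_digraph.cas G u p v \<Longrightarrow> Suc i < length p \<Longrightarrow> head G (p ! i) = tail G (p ! Suc i)"
proof (induction p arbitrary: u i)
  case (Cons e p)
  then show ?case
    by (cases i; cases p) (auto simp: pre_digraph.cas.simps)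
qed simp

lemma closed_cas_nth:
  assumes "pre_digraph.cas G u p u" and "i < length p"
  shows "head G (p ! i) = tail G (p ! (Suc i mod length p))"
\<comment> \<open>Closedness matters only at the last arc, whose head \<open>u\<close> is the tail
  of the first.\<close>
proof (cases "Suc i = length p")
  case True
  then have "p \<noteq> []" "i = length p - 1" by auto
  then show ?thesis
    using cas_tail_hd[OF assms(1)] cas_head_last[OF assms(1)]
    by (simp add: hd_conv_nth last_conv_nth)
next
  case False
  then show ?thesis using cas_nth[OF assms(1)] assms(2) by simp
qed

text \<open>By the overlaps, letter \<open>Suc j\<close> of an arc is letter \<open>j\<close> of the
  next one, so letter \<open>j\<close> of \<open>p ! i\<close> is the first letter of the arc
  \<open>j\<close> steps later. Since indices are reduced modulo \<open>length p\<close>, a trail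
  shorter than \<open>n\<close> is covered too.\<close>

lemma cyclic_window_map_hd:
  assumes len: "\<And>w. w \<in> set p \<Longrightarrow> length w = n"
    and overlap: "\<And>i. i < length p \<Longrightarrow> tl (p ! i) = butlast (p ! (Suc i mod length p))"
    and i: "i < length p"
  shows "cyclic_window (map hd p) n i = p ! i"
proof -
  have "p \<noteq> []" using i by auto
  have shift: "j < n \<Longrightarrow> i < length p \<Longrightarrow> p ! i ! j = hd (p ! ((i + j) mod length p))" for i j
  proof (induction j arbitrary: i)
    case 0
    then have "p ! i \<noteq> []" using len[of "p ! i"] by auto
    with 0 show ?case by (simp add: hd_conv_nth)
  next
    case (Suc j)
    let ?i = "Suc i mod length p"
    have "?i < length p" using \<open>p \<noteq> []\<close> by simp
    then have li: "length (p ! i) = n" "length (p ! ?i) = n" using len Suc.prems by auto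
    have "p ! i ! Suc j = tl (p ! i) ! j" using li Suc.prems by (simp add: nth_tl)
    also have "\<dots> = p ! ?i ! j"
      using overlap[OF Suc.prems(2)] li Suc.prems by (simp add: nth_butlast)
    also have "\<dots> = hd (p ! ((?i + j) mod length p))"
      using Suc.IH[of ?i] Suc.prems \<open>?i < length p\<close> by simp
    also have "(?i + j) mod length p = (i + Suc j) mod length p"
      by (simp add: mod_add_left_eq)
    finally show ?case .
  qed
  show ?thesis
    using i len[of "p ! i"] shift[OF _ i] \<open>p \<noteq> []\<close>
    by (intro nth_equalityI) (simp_all add: cyclic_window_def)
qed

lemma universal_cycle_if_connected:
  assumes "finite C" and len: "\<And>w. w \<in> C \<Longrightarrow> length w = n"
    and rot: "\<And>w. rotate1 w \<in> C \<longleftrightarrow> w \<in> C"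
    and con: "connected (word_graph C)"
  shows "\<exists>xs. universal_cycle n C xs"
proof -
  interpret wf_digraph "word_graph C" using rot by (rule wf_digraph_word_graph)
  interpret fin_digraph "word_graph C" using \<open>finite C\<close> by unfold_locales simp_all
  obtain u p where "euler_trail u p u"
    using closed_euler1[OF con] word_graph_balanced[OF rot] by blast
  then have p: "cas u p u" "distinct p" "set p = C"
    by (auto simp: euler_trail_def trail_def awalk_def)
  have "cyclic_window (map hd p) n i = p ! i" if "i < length p" for i
    using closed_cas_nth[OF p(1)] that len p(3) by (intro cyclic_window_map_hd) simp_all
  moreover have "bij_betw ((!) p) {..<length p} C"
    using p(2,3) by (simp add: bij_betw_nth)
  ultimately have "bij_betw (cyclic_window (map hd p) n) {..<length p} C"
    by (subst bij_betw_cong) auto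
  moreover have "length p = card C" using p(2,3) distinct_card by fastforce
  ultimately have "universal_cycle n C (map hd p)" by (simp add: universal_cycle_def)
  then show ?thesis ..
qed

lemma rotate1_mem_non_onto_words:
  "rotate1 w \<in> non_onto_words n k \<longleftrightarrow> w \<in> non_onto_words n k"
  by (simp add: non_onto_words_eq)

lemma finite_non_onto_words: "finite (non_onto_words n k)"
proof (rule finite_subset)
  show "non_onto_words n k \<subseteq> {w. set w \<subseteq> {1..k} \<and> length w = n}"
    by (auto simp: non_onto_words_eq)
  show "finite {w. set w \<subseteq> {1..k} \<and> length w = n}"
    by (rule finite_lists_length_eq) simp
qed

text \<open>Appending the letters of \<open>v\<close> to \<open>u\<close> one at a time only passes through words over the letters
  of \<open>u\<close> and \<open>v\<close>.\<close>

lemma non_onto_reachable: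
  assumes len: "length u = m" "length v = m" and "m > 0"
    and sub: "set u \<union> set v \<subset> {1..k}"
  shows "u \<rightarrow>\<^sup>*\<^bsub>word_graph (non_onto_words (Suc m) k)\<^esub> v"
proof -
  let ?C = "non_onto_words (Suc m) k"
  let ?G = "word_graph ?C"
  interpret wf_digraph ?G using rotate1_mem_non_onto_words by (rule wf_digraph_word_graph)
  have step: "drop j u @ take (Suc j) v \<in> ?C"
    "butlast (drop j u @ take (Suc j) v) = drop j u @ take j v"
    "tl (drop j u @ take (Suc j) v) = drop (Suc j) u @ take (Suc j) v" if "j < m" for j
  proof -
    have "set (drop j u @ take (Suc j) v) \<subseteq> set u \<union> set v"
      by (auto dest: in_set_dropD in_set_takeD)
    then have "set (drop j u @ take (Suc j) v) \<subset> {1..k}" using sub by (rule subset_psubset_trans)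
    then show "drop j u @ take (Suc j) v \<in> ?C"
      using len that by (auto simp: non_onto_words_eq)
    show "butlast (drop j u @ take (Suc j) v) = drop j u @ take j v"
      using len that by (simp add: take_Suc_conv_app_nth butlast_append)
    show "tl (drop j u @ take (Suc j) v) = drop (Suc j) u @ take (Suc j) v"
      using len that by (simp add: drop_Suc tl_drop)
  qed
  have "u \<rightarrow>\<^sup>*\<^bsub>?G\<^esub> (drop j u @ take j v)" if "j \<le> m" for j
    using that
  proof (induction j)
    case 0
    \<comment> \<open>Reachability in zero steps still requires \<open>u\<close> to be a vertex; it
      is the tail of the first arc, which exists as \<open>m > 0\<close>.\<close>
    have "u \<in> butlast ` ?C" using step(1,2)[OF \<open>m > 0\<close>] by (metis append_Nil2 drop0 imageI take0)
    then show ?case by simp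
  next
    case (Suc j)
    have "(drop j u @ take j v, drop (Suc j) u @ take (Suc j) v) \<in> arcs_ends ?G"
      unfolding arcs_ends_conv using step[of j] Suc.prems by (force simp: image_iff)
    with Suc show ?case by (auto intro: reachable_adj_trans)
  qed
  from this[of m] show ?thesis using len by simp
qed

lemma connected_non_onto:
  assumes "m > 0" and "k > 2"
  shows "connected (word_graph (non_onto_words (Suc m) k))"
proof -
  let ?C = "non_onto_words (Suc m) k"
  interpret wf_digraph "word_graph ?C"
    using rotate1_mem_non_onto_words by (rule wf_digraph_word_graph)
  \<comment> \<open>A letter missing from a word is missing from its prefix, hence the strict
    inclusion.\<close>
  have vert: "length u = m \<and> set u \<subset> {1..k}" if "u \<in> butlast ` ?C" for u
    using that by (auto simp: non_onto_words_eq dest: in_set_butlastD)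
  have "u \<rightarrow>\<^sup>*\<^bsub>word_graph ?C\<^esub> v" if u: "u \<in> butlast ` ?C" and v: "v \<in> butlast ` ?C" for u v
  proof -
    have "u \<noteq> []" "v \<noteq> []" using vert[OF u] vert[OF v] \<open>m > 0\<close> by auto
    then obtain a b where ab: "a \<in> set u" "b \<in> set v" by (meson list.set_sel(1))
    \<comment> \<open>The letters of \<open>u\<close> and \<open>v\<close> together may exhaust the
      alphabet, which rules out a direct walk; two letters cannot, as \<open>k > 2\<close>.\<close>
    have "card {a, b} < card {1..k}" using \<open>k > 2\<close> by (simp add: card_insert_if)
    then have "{a, b} \<subset> {1..k}" using ab vert[OF u] vert[OF v] by force
    then have "replicate m a \<rightarrow>\<^sup>*\<^bsub>word_graph ?C\<^esub> replicate m b"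
      using \<open>m > 0\<close> by (intro non_onto_reachable) auto
    \<comment> \<open>As \<open>a\<close> occurs in \<open>u\<close>, this walk uses only letters of
      \<open>u\<close>, which miss some letter of the alphabet.\<close>
    moreover have "u \<rightarrow>\<^sup>*\<^bsub>word_graph ?C\<^esub> replicate m a"
      using \<open>m > 0\<close> vert[OF u] ab by (intro non_onto_reachable) (auto simp: insert_absorb)
    moreover have "replicate m b \<rightarrow>\<^sup>*\<^bsub>word_graph ?C\<^esub> v"
      using \<open>m > 0\<close> vert[OF v] ab by (intro non_onto_reachable) (auto simp: insert_absorb)
    ultimately show ?thesis by (blast intro: reachable_trans)
  qed
  \<comment> \<open>Strong connectedness includes having a vertex; this word provides one, since it
    misses the letter 2.\<close>
  moreover have "replicate (Suc m) 1 \<in> ?C"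
    using \<open>k > 2\<close> by (auto simp: non_onto_words_eq intro!: bexI[of _ 2])
  ultimately have "strongly_connected (word_graph ?C)"
    by (auto simp: strongly_connected_def)
  then show ?thesis
    by (intro connectedI) (auto simp: strongly_connected_def intro: reachable_mk_symmetricI)
qed

theorem theorem6:
  fixes n k :: nat
  assumes "n \<ge> k" and "k > 2"
  shows "\<exists>xs. universal_cycle n (non_onto_words n k) xs"
proof (rule universal_cycle_if_connected)
  show "connected (word_graph (non_onto_words n k))"
    \<comment> \<open>Prefixes have length \<open>n - 1\<close>, which is positive because
      \<open>n \<ge> k > 2\<close>.\<close>
    using connected_non_onto[of "n - 1" k] assms by simp
qed (simp_all add: finite_non_onto_words rotate1_mem_non_onto_words, simp add: non_onto_words_eq)

end
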